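(* Every connected permutation graph has a multi-chain ordering.
   Context: A permutation graph is a graph with vertex set $\{x_1,\dots,x_n\}$ and edge set $\{x_ix_j: i<j,\ \pi(i)<\pi(j)\}$ for some permutation $\pi$ of $\{1,\dots,n\}$ (equivalently, a simple graph that is both a comparability graph and a cocomparability graph). A chain graph is a bipartite graph (with given sides) containing no induced $2K_2$. For a connected graph $G$ and vertex $v_0$, the distance layers are $L_0=\{v_0\},L_1,\dots,L_z$ with $L_i$ the set of vertices at distance $i$ from $v_0$ and $z$ maximal with $L_z\ne\emptyset$. They form a multi-chain ordering if for each $0\le i<z$ the bipartite graph with sides $L_i,L_{i+1}$ and the edges of $G$ between them is a chain graph. A connected graph has a multi-chain ordering if such $v_0$ exists. *)

theory Defs
  imports
    "Graph_Theory.Graph_Theory"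
    "HOL-Combinatorics.Permutations"
begin

text \<open>
  Finite simple graphs are represented, as usual in \<^theory>\<open>Graph_Theory.Pair_Digraph\<close>, by symmetric
  loop-free digraphs (\<^const>\<open>pair_graph\<close>): the edge \<open>uv\<close> is the pair of arcs \<open>(u, v)\<close>, \<open>(v, u)\<close>.
\<close>

definition permutation_graph :: "'a pair_pre_digraph \<Rightarrow> bool" where
  "permutation_graph G \<longleftrightarrow>
    (\<exists>(n::nat) x \<pi>. bij_betw x {1..n} (pverts G) \<and> \<pi> permutes {1..n} \<and>
      parcs G = symcl {(x i, x j) | i j. i \<in> {1..n} \<and> j \<in> {1..n} \<and> i < j \<and> \<pi> i < \<pi> j})"

lemma permutation_graph_imp_pair_graph:
  assumes "permutation_graph G"
  shows "pair_graph G"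
proof -
  obtain n :: nat and x and \<pi> :: "nat \<Rightarrow> nat" where x: "bij_betw x {1..n} (pverts G)" and
    arcs: "parcs G = symcl {(x i, x j) | i j. i \<in> {1..n} \<and> j \<in> {1..n} \<and> i < j \<and> \<pi> i < \<pi> j}"
    using assms unfolding permutation_graph_def by blast
  have V: "pverts G = x ` {1..n}" and inj: "inj_on x {1..n}"
    using x by (auto simp: bij_betw_def)
  have sym: "sym (symcl R)" for R :: "'a rel"
    unfolding symcl_def sym_def by force
  have sub: "parcs G \<subseteq> pverts G \<times> pverts G"
    unfolding arcs V symcl_def by auto
  have fin: "finite (pverts G)"
    unfolding V by simp
  show ?thesis
  proof
    show "finite (parcs G)"
      using sub fin by (meson finite_SigmaI finite_subset)
    show "fst e \<noteq> snd e" if "e \<in> parcs G" for e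
      using that inj unfolding arcs symcl_def by (auto simp: inj_on_eq_iff)
    show "symmetric (with_proj G)"
      unfolding symmetric_def with_proj_simps arcs by (rule sym)
  qed (use sub fin in auto)
qed

definition bipartite_with_sides :: "'a set \<Rightarrow> 'a set \<Rightarrow> 'a pair_pre_digraph \<Rightarrow> bool" where
  "bipartite_with_sides A B H \<longleftrightarrow>
    pair_graph H \<and> pverts H = A \<union> B \<and> A \<inter> B = {} \<and> parcs H \<subseteq> A \<times> B \<union> B \<times> A"

definition is_2K2 :: "'a pair_pre_digraph \<Rightarrow> bool" where
  "is_2K2 K \<longleftrightarrow>
    (\<exists>a b c d. distinct [a, b, c, d] \<and> pverts K = {a, b, c, d} \<and>
      parcs K = {(a, b), (b, a), (c, d), (d, c)})"

definition chain_graph :: "'a set \<Rightarrow> 'a set \<Rightarrow> 'a pair_pre_digraph \<Rightarrow> bool" where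
  "chain_graph A B H \<longleftrightarrow>
    bipartite_with_sides A B H \<and>
    \<not> (\<exists>K. is_2K2 K \<and> induced_subgraph (with_proj K) (with_proj H))"

definition edges_between :: "'a pair_pre_digraph \<Rightarrow> 'a set \<Rightarrow> 'a set \<Rightarrow> 'a pair_pre_digraph" where
  "edges_between G A B = \<lparr>pverts = A \<union> B, parcs = parcs G \<inter> (A \<times> B \<union> B \<times> A)\<rparr>"

text \<open>Graph distance is the shortest-path distance for unit arc weights; it is \<open>\<infinity>\<close> between vertices
  in different components, which then lie in no layer.\<close>

definition distance_layer :: "'a pair_pre_digraph \<Rightarrow> 'a \<Rightarrow> nat \<Rightarrow> 'a set" where
  "distance_layer G v\<^sub>0 i =
    {v \<in> pverts G. wf_digraph.\<mu> (with_proj G) (\<lambda>_. 1) v\<^sub>0 v = ereal (real i)}"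

lemma distance_layer_0:
  assumes "pair_graph G" "v\<^sub>0 \<in> pverts G"
  shows "distance_layer G v\<^sub>0 0 = {v\<^sub>0}"
proof -
  interpret pair_graph G by fact
  have "v = v\<^sub>0" if "v \<in> pverts G" "\<mu> (\<lambda>_. 1) v\<^sub>0 v = 0" for v
  proof -
    have "v\<^sub>0 \<rightarrow>\<^sup>*\<^bsub>with_proj G\<^esub> v"
      using that by (subst \<mu>_reach_conv[symmetric, where f = "\<lambda>_. 1"]) simp
    then obtain p where p: "apath v\<^sub>0 p v" "\<mu> (\<lambda>_. 1) v\<^sub>0 v = awalk_cost (\<lambda>_. 1) p"
      using min_cost_awalk[where c = "\<lambda>_. 1"] by fastforce
    with that have "p = []"
      by (simp add: awalk_cost_def sum_list_triv)
    with p show ?thesis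
      by (simp add: apath_Nil_iff)
  qed
  moreover have "\<mu> (\<lambda>_. 1) v\<^sub>0 v\<^sub>0 = 0"
  proof (rule antisym)
    show "\<mu> (\<lambda>_. 1) v\<^sub>0 v\<^sub>0 \<le> 0"
      using min_cost_le_walk_cost[of v\<^sub>0 "[]" v\<^sub>0 "\<lambda>_. 1"] assms(2) by (simp add: awalk_Nil_iff zero_ereal_def)
    show "0 \<le> \<mu> (\<lambda>_. 1) v\<^sub>0 v\<^sub>0"
      unfolding \<mu>_def by (auto intro!: INF_greatest simp: awalk_cost_def sum_list_triv)
  qed
  ultimately show ?thesis
    using assms(2) by (auto simp: distance_layer_def zero_ereal_def)
qed

lemma finite_nonempty_distance_layers:
  assumes "pair_graph G"
  shows "finite {i. distance_layer G v\<^sub>0 i \<noteq> {}}"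
proof -
  interpret pair_graph G by fact
  have "{i. distance_layer G v\<^sub>0 i \<noteq> {}}
      \<subseteq> (\<lambda>v. THE i. \<mu> (\<lambda>_. 1) v\<^sub>0 v = ereal (real i)) ` pverts G"
    by (auto simp: distance_layer_def image_iff intro!: bexI the_equality[symmetric])
  then show ?thesis
    by (rule finite_subset) (simp add: pair_finite_verts)
qed

definition multi_chain_ordering :: "'a pair_pre_digraph \<Rightarrow> 'a \<Rightarrow> bool" where
  "multi_chain_ordering G v\<^sub>0 \<longleftrightarrow>
    (\<forall>i < Max {i. distance_layer G v\<^sub>0 i \<noteq> {}}.
      chain_graph (distance_layer G v\<^sub>0 i) (distance_layer G v\<^sub>0 (Suc i))
        (edges_between G (distance_layer G v\<^sub>0 i) (distance_layer G v\<^sub>0 (Suc i))))"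

definition has_multi_chain_ordering :: "'a pair_pre_digraph \<Rightarrow> bool" where
  "has_multi_chain_ordering G \<longleftrightarrow> (\<exists>v\<^sub>0 \<in> pverts G. multi_chain_ordering G v\<^sub>0)"

end

theory Submission
  imports Defs
begin

text \<open>
  Draw the permutation graph as points \<open>(i, \<pi> i)\<close> in the plane, adjacent iff one dominates the other,
  and take the leftmost point as \<open>v\<^sub>0\<close>. As dominance is transitive, all edges from \<open>L\<^sub>i\<close> to
  \<open>L\<^sub>i\<^sub>+\<^sub>1\<close> go up for even \<open>i\<close> and down for odd \<open>i\<close>. Moreover a point of \<open>L\<^sub>i\<close> that is not adjacent to
  \<open>b \<in> L\<^sub>i\<^sub>+\<^sub>1\<close> lies to the upper left of \<open>b\<close>: the whole shortest path leading to it avoids the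
  neighbours of \<open>b\<close>, and such a path cannot cross from the upper left to the lower right of \<open>b\<close>.
  Hence an induced \<open>2K\<^sub>2\<close> with edges \<open>ab\<close>, \<open>cd\<close> between \<open>L\<^sub>i\<close> and \<open>L\<^sub>i\<^sub>+\<^sub>1\<close> would give a cyclic chain of
  inequalities in one of the two coordinates.
\<close>

section \<open>Induced 2K2s between two sides\<close>

lemma chain_graph_edges_between:
  assumes "pair_graph G" "A \<subseteq> pverts G" "B \<subseteq> pverts G" "A \<inter> B = {}"
    and no2K2: "\<And>a b c d. \<lbrakk>a \<in> A; b \<in> B; c \<in> A; d \<in> B; (a, b) \<in> parcs G; (c, d) \<in> parcs G;
      (a, d) \<notin> parcs G; (c, b) \<notin> parcs G\<rbrakk> \<Longrightarrow> False"
  shows "chain_graph A B (edges_between G A B)"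
proof -
  interpret pair_graph G by fact
  let ?H = "edges_between G A B"
  have sym: "(v, u) \<in> parcs G" if "(u, v) \<in> parcs G" for u v
    using that arcs_symmetric by blast
  have pg: "pair_graph ?H"
  proof
    show "finite (pverts ?H)"
      using assms(2,3) finite_subset[OF _ pair_finite_verts] by (auto simp: edges_between_def)
    show "finite (parcs ?H)"
      using pair_finite_arcs by (auto simp: edges_between_def)
    show "fst e \<noteq> snd e" if "e \<in> parcs ?H" for e
      using that pair_no_loops by (auto simp: edges_between_def)
    show "symmetric (with_proj ?H)"
      unfolding symmetric_def with_proj_simps edges_between_def sym_def using sym by auto
  qed (auto simp: edges_between_def)
  have "\<not> induced_subgraph (with_proj K) (with_proj ?H)" if K: "is_2K2 K" for K
  proof
    assume ind: "induced_subgraph (with_proj K) (with_proj ?H)"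
    obtain a b c d where dist: "distinct [a, b, c, d]" and V: "pverts K = {a, b, c, d}"
      and E: "parcs K = {(a, b), (b, a), (c, d), (d, c)}"
      using K unfolding is_2K2_def by blast
    have EH: "parcs K = {e \<in> parcs ?H. fst e \<in> pverts K \<and> snd e \<in> pverts K}"
      using ind by (simp add: induced_subgraph_def)
    \<comment> \<open>Orienting both edges of \<open>K\<close> from \<open>A\<close> to
      \<open>B\<close> leaves just two cross pairs to test, \<open>(u, t)\<close> and
      \<open>(s, v)\<close>.\<close>
    have side: "\<exists>u\<in>A. \<exists>v\<in>B. {u, v} = {x, y} \<and> (u, v) \<in> parcs G" if "(x, y) \<in> parcs K" for x y
    proof -
      have "(x, y) \<in> parcs ?H"
        using that EH by blast
      then show ?thesis
        using sym by (auto simp: edges_between_def)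
    qed
    obtain u v where uv: "u \<in> A" "v \<in> B" "{u, v} = {a, b}" "(u, v) \<in> parcs G"
      using side[of a b] E by blast
    obtain s t where st: "s \<in> A" "t \<in> B" "{s, t} = {c, d}" "(s, t) \<in> parcs G"
      using side[of c d] E by blast
    \<comment> \<open>Inducedness enters here: such a pair, if joined in \<open>G\<close>, would be
      an arc of \<open>?H\<close> and hence of \<open>K\<close>.\<close>
    have non: "(x, y) \<notin> parcs G" if "x \<in> A" "y \<in> B" "x \<in> {a, b, c, d}" "y \<in> {a, b, c, d}"
      "(x, y) \<notin> parcs K" for x y
      using that EH V by (auto simp: edges_between_def)
    have mem: "u \<in> {a, b, c, d}" "v \<in> {a, b, c, d}" "s \<in> {a, b, c, d}" "t \<in> {a, b, c, d}"
      using uv(3) st(3) by blast+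
    have "(u, t) \<notin> parcs K" "(s, v) \<notin> parcs K"
      using dist uv(3) st(3) unfolding E doubleton_eq_iff by auto
    then have "(u, t) \<notin> parcs G" "(s, v) \<notin> parcs G"
      using non[OF uv(1) st(2) mem(1,4)] non[OF st(1) uv(2) mem(3,2)] by simp_all
    then show False
      using no2K2[OF uv(1,2) st(1,2) uv(4) st(4)] by simp
  qed
  then show ?thesis
    unfolding chain_graph_def bipartite_with_sides_def
    using pg assms(4) by (auto simp: edges_between_def)
qed

section \<open>Distance layers in terms of walk lengths\<close>

context pair_graph
begin

text \<open>With unit weights the cost of a walk is its length, and a finite infimum is attained by
  some path; this removes extended reals from the later arguments.\<close>

lemma distance_layer_iff_awalk:
  "v \<in> distance_layer G s k \<longleftrightarrow>
    v \<in> pverts G \<and> (\<exists>p. awalk s p v \<and> length p = k) \<and> (\<forall>p. awalk s p v \<longrightarrow> k \<le> length p)"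
proof -
  have cost: "awalk_cost (\<lambda>_. 1) p = real (length p)" for p :: "('a \<times> 'a) list"
    by (simp add: awalk_cost_def sum_list_triv)
  have "(\<exists>p. awalk s p v \<and> length p = k) \<and> (\<forall>p. awalk s p v \<longrightarrow> k \<le> length p)"
    if \<mu>: "\<mu> (\<lambda>_. 1) s v = ereal (real k)"
  proof -
    have "s \<rightarrow>\<^sup>*\<^bsub>with_proj G\<^esub> v"
      using \<mu> by (subst \<mu>_reach_conv[symmetric, where f = "\<lambda>_. 1"]) simp
    then obtain p where "apath s p v" "\<mu> (\<lambda>_. 1) s v = awalk_cost (\<lambda>_. 1) p"
      using min_cost_awalk[where c = "\<lambda>_. 1"] by fastforce
    then have "awalk s p v \<and> length p = k"
      using \<mu> by (simp add: cost apath_def)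
    moreover have "k \<le> length p" if "awalk s p v" for p
      using min_cost_le_walk_cost[OF that, of "\<lambda>_. 1"] \<mu> by (simp add: cost)
    ultimately show ?thesis by blast
  qed
  moreover have "\<mu> (\<lambda>_. 1) s v = ereal (real k)"
    if "awalk s p v" "length p = k" and min: "\<forall>p. awalk s p v \<longrightarrow> k \<le> length p" for p
  proof (rule antisym)
    show "\<mu> (\<lambda>_. 1) s v \<le> ereal (real k)"
      using min_cost_le_walk_cost[OF that(1), of "\<lambda>_. 1"] that(2) by (simp add: cost)
    show "ereal (real k) \<le> \<mu> (\<lambda>_. 1) s v"
      unfolding \<mu>_def using min by (auto intro!: INF_greatest simp: cost)
  qed
  ultimately show ?thesis
    unfolding distance_layer_def by blast
qed

lemma distance_layer_unique:
  "\<lbrakk>v \<in> distance_layer G s i; v \<in> distance_layer G s j\<rbrakk> \<Longrightarrow> i = j"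
  by (simp add: distance_layer_def)

text \<open>Deleting the last arc of a shortest walk leaves a shortest walk, since a shorter one
  could be extended by that arc.\<close>

lemma distance_layer_SucE:
  assumes "v \<in> distance_layer G s (Suc i)"
  obtains u where "u \<in> distance_layer G s i" "(u, v) \<in> parcs G"
proof -
  obtain p where p: "awalk s p v" "length p = Suc i" and min: "\<And>p. awalk s p v \<Longrightarrow> Suc i \<le> length p"
    using assms unfolding distance_layer_iff_awalk by blast
  obtain r e where re: "p = r @ [e]"
    using p(2) by (cases p rule: rev_cases) auto
  obtain u where u: "awalk s r u" "awalk u [e] v"
    using p(1) unfolding re by auto
  then have e: "e = (u, v)" "(u, v) \<in> parcs G" "u \<in> pverts G"
    by (auto simp: awalk_simps)
  have "i \<le> length r'" if "awalk s r' u" for r'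
    using min[of "r' @ [e]"] that u(2) by (auto intro: awalk_appendI)
  then have "u \<in> distance_layer G s i"
    using u(1) e p(2) unfolding distance_layer_iff_awalk re by auto
  with e that show thesis by blast
qed

text \<open>Used to show that no edge skips a layer. The extended walk also shows that
  \<open>v\<close> is reachable, so that it lies in some layer.\<close>

lemma distance_layer_adjacent:
  assumes "u \<in> distance_layer G s i" "(u, v) \<in> parcs G"
  obtains j where "j \<le> Suc i" "v \<in> distance_layer G s j"
proof -
  obtain p where p: "awalk s p u" "length p = i"
    using assms unfolding distance_layer_iff_awalk by blast
  have "awalk u [(u, v)] v"
    using assms(2) in_arcsD1 in_arcsD2 by (auto simp: awalk_simps)
  then have w: "awalk s (p @ [(u, v)]) v"
    using p(1) by (rule awalk_appendI[rotated])
  define P where "P k \<longleftrightarrow> (\<exists>p. awalk s p v \<and> length p = k)" for k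
  have P: "P (Suc i)"
    unfolding P_def using w p(2) by (intro exI[of _ "p @ [(u, v)]"]) simp
  have "v \<in> distance_layer G s (Least P)"
    unfolding distance_layer_iff_awalk
  proof (intro conjI allI impI)
    show "v \<in> pverts G"
      using in_arcsD2[OF assms(2)] .
    show "\<exists>p. awalk s p v \<and> length p = Least P"
      using LeastI[of P, OF P] unfolding P_def .
    show "Least P \<le> length r" if "awalk s r v" for r
      using that by (intro Least_le) (auto simp: P_def)
  qed
  moreover have "Least P \<le> Suc i"
    using P by (rule Least_le)
  ultimately show thesis
    using that by blast
qed

end

section \<open>Layers of points in the plane under dominance\<close>

locale dominance_graph = pair_graph G for G :: "'a pair_pre_digraph" +
  fixes p q :: "'a \<Rightarrow> nat" and v0 :: 'a
  assumes inj_p: "inj_on p (pverts G)" and inj_q: "inj_on q (pverts G)"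
    and adj: "\<And>u v. \<lbrakk>u \<in> pverts G; v \<in> pverts G\<rbrakk> \<Longrightarrow>
      (u, v) \<in> parcs G \<longleftrightarrow> p u < p v \<and> q u < q v \<or> p v < p u \<and> q v < q u"
    and v0: "v0 \<in> pverts G"
    and leftmost: "\<And>v. v \<in> pverts G \<Longrightarrow> p v0 \<le> p v"
begin

abbreviation L :: "nat \<Rightarrow> 'a set" where
  "L \<equiv> distance_layer G v0"

lemma layer_subset: "L i \<subseteq> pverts G"
  by (auto simp: distance_layer_def)

lemma L_0: "L 0 = {v0}"
  using distance_layer_0[OF pair_graph_axioms v0] .

text \<open>A predecessor \<open>w\<close> of \<open>u\<close> is not adjacent to \<open>v\<close>,
  two layers further on. If \<open>uv\<close> continued in the direction of \<open>wu\<close>,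
  transitivity would make \<open>w\<close> and \<open>v\<close> adjacent; so directions
  alternate.\<close>

lemma edge_direction:
  assumes "u \<in> L i" "v \<in> L (Suc i)" "(u, v) \<in> parcs G"
  shows "if even i then p u < p v \<and> q u < q v else p v < p u \<and> q v < q u"
  using assms
proof (induction i arbitrary: u v)
  case 0
  then show ?case
    using adj[of u v] leftmost[of v] layer_subset L_0 by fastforce
next
  case (Suc i)
  obtain w where w: "w \<in> L i" "(w, u) \<in> parcs G"
    using distance_layer_SucE Suc.prems(1) by blast
  have V: "u \<in> pverts G" "v \<in> pverts G" "w \<in> pverts G"
    using Suc.prems w layer_subset by blast+
  have "(w, v) \<notin> parcs G"
  proof
    assume "(w, v) \<in> parcs G"
    then obtain j where "j \<le> Suc i" "v \<in> L j"
      using distance_layer_adjacent[OF w(1)] by blast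
    then show False
      using distance_layer_unique[OF Suc.prems(2)] by fastforce
  qed
  then show ?case
    using Suc.IH[OF w(1) Suc.prems(1) w(2)] Suc.prems(3) adj[of u v] adj[of w v] V
    by (auto split: if_splits)
qed

lemma nonadjacent_upper_left:
  assumes "b \<in> L m" "m > 0" "c \<in> L i" "i < m" "(c, b) \<notin> parcs G"
  shows "p c < p b \<and> q b < q c"
  using assms(3-5)
proof (induction i arbitrary: c)
  case 0
  have c: "c = v0" "b \<in> pverts G"
    using 0 L_0 assms(1) layer_subset by auto
  have "b \<noteq> v0"
    using assms(1,2) distance_layer_unique[of v0 v0 0 m] L_0 by auto
  then have "p c \<noteq> p b" "q c \<noteq> q b"
    using inj_p inj_q c v0 by (auto simp: inj_on_eq_iff)
  \<comment> \<open>No two points share a coordinate, so a non-neighbour is strictly upper left or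
    lower right; \<open>leftmost\<close> decides.\<close>
  then show ?case
    using leftmost[of b] adj[of c b] 0 c v0 by auto
next
  case (Suc i)
  obtain w where w: "w \<in> L i" "(w, c) \<in> parcs G"
    using distance_layer_SucE Suc.prems(1) by blast
  have V: "b \<in> pverts G" "c \<in> pverts G" "w \<in> pverts G"
    using Suc.prems assms(1) w layer_subset by blast+
  \<comment> \<open>Such an arc would put \<open>b\<close> at distance at most \<open>Suc i\<close>,
    which is less than \<open>m\<close>.\<close>
  have "(w, b) \<notin> parcs G"
  proof
    assume "(w, b) \<in> parcs G"
    then obtain j where "j \<le> Suc i" "b \<in> L j"
      using distance_layer_adjacent[OF w(1)] by blast
    then show False
      using distance_layer_unique[OF assms(1)] Suc.prems(2) by fastforce
  qed
  then have wb: "p w < p b \<and> q b < q w"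
    using Suc.IH[OF w(1)] Suc.prems(2) by simp
  have "b \<noteq> c"
    using distance_layer_unique[OF assms(1)] Suc.prems(1,2) by blast
  then have "p c \<noteq> p b" "q c \<noteq> q b"
    using inj_p inj_q V by (auto simp: inj_on_eq_iff)
  \<comment> \<open>If \<open>c\<close> were to the lower right of \<open>b\<close>, it would also
    be to the lower right of \<open>w\<close>, contradicting the edge \<open>wc\<close>.\<close>
  then show ?case
    using wb Suc.prems(3) w(2) adj[of w c] adj[of c b] V by auto
qed

lemma multi_chain_ordering_v0: "multi_chain_ordering G v0"
  unfolding multi_chain_ordering_def
proof (intro allI impI chain_graph_edges_between)
  fix i
  show "pair_graph G" by (rule pair_graph_axioms)
  show "L i \<subseteq> pverts G" "L (Suc i) \<subseteq> pverts G"
    by (rule layer_subset)+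
  show "L i \<inter> L (Suc i) = {}"
    using distance_layer_unique[of _ _ i "Suc i"] by auto
  fix a b c d
  assume L: "a \<in> L i" "b \<in> L (Suc i)" "c \<in> L i" "d \<in> L (Suc i)"
    and edges: "(a, b) \<in> parcs G" "(c, d) \<in> parcs G"
    and nonedges: "(a, d) \<notin> parcs G" "(c, b) \<notin> parcs G"
  have "p a < p d \<and> q d < q a" "p c < p b \<and> q b < q c"
    using nonadjacent_upper_left L nonedges by blast+
  moreover note edge_direction[OF L(1,2) edges(1)] edge_direction[OF L(3,4) edges(2)]
  \<comment> \<open>The cycle is \<open>q a < q b < q c < q d < q a\<close> for even
    \<open>i\<close> and \<open>p b < p a < p d < p c < p b\<close> for odd
    \<open>i\<close>.\<close>
  ultimately show False
    by (auto split: if_splits)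
qed

end

section \<open>From the permutation to points in the plane\<close>

theorem theorem1:
  fixes G :: "'a pair_pre_digraph"
  assumes "permutation_graph G" and "connected (with_proj G)"
  shows "has_multi_chain_ordering G"
proof -
  obtain n :: nat and x and \<pi> :: "nat \<Rightarrow> nat" where x: "bij_betw x {1..n} (pverts G)"
    and \<pi>: "\<pi> permutes {1..n}"
    and arcs: "parcs G = symcl {(x i, x j) | i j. i \<in> {1..n} \<and> j \<in> {1..n} \<and> i < j \<and> \<pi> i < \<pi> j}"
    using assms(1) unfolding permutation_graph_def by blast
  \<comment> \<open>The index of a vertex is its horizontal coordinate, so \<open>x 1\<close> is
    leftmost.\<close>
  define p where "p = inv_into {1..n} x"
  have V: "pverts G = x ` {1..n}" and inj: "inj_on x {1..n}"
    using x by (auto simp: bij_betw_def)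
  have px: "p (x i) = i" if "i \<in> {1..n}" for i
    using inj that by (simp add: p_def)
  \<comment> \<open>Connectedness includes having a vertex; hence \<open>x 1\<close> exists.\<close>
  have "pverts G \<noteq> {}"
    using assms(2) by (auto simp: connected_def strongly_connected_def)
  then have n: "1 \<in> {1..n}"
    using V by auto
  interpret pair_graph G
    using assms(1) by (rule permutation_graph_imp_pair_graph)
  interpret dominance_graph G p "\<pi> \<circ> p" "x 1"
  proof
    show "inj_on p (pverts G)"
      unfolding V by (auto intro!: inj_onI simp: px)
    then show "inj_on (\<pi> \<circ> p) (pverts G)"
      using permutes_inj[OF \<pi>] by (auto intro: comp_inj_on inj_on_subset)
    show "x 1 \<in> pverts G"
      using n V by blast
    show "p (x 1) \<le> p v" if "v \<in> pverts G" for v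
      using that n px by (auto simp: V)
    show "(u, v) \<in> parcs G \<longleftrightarrow>
        p u < p v \<and> (\<pi> \<circ> p) u < (\<pi> \<circ> p) v \<or> p v < p u \<and> (\<pi> \<circ> p) v < (\<pi> \<circ> p) u"
      if uv: "u \<in> pverts G" "v \<in> pverts G" for u v
    proof -
      obtain i j where ij: "u = x i" "i \<in> {1..n}" "v = x j" "j \<in> {1..n}"
        using uv V by auto
      \<comment> \<open>Injectivity of \<open>x\<close> makes the indices bound in the set agree
        with the given ones.\<close>
      have mem: "(x i, x j) \<in> {(x i, x j) | i j. i \<in> {1..n} \<and> j \<in> {1..n} \<and> i < j \<and> \<pi> i < \<pi> j}
          \<longleftrightarrow> i < j \<and> \<pi> i < \<pi> j" if "i \<in> {1..n}" "j \<in> {1..n}" for i j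
        using that inj_onD[OF inj] by blast
      have "(s, t) \<in> symcl R \<longleftrightarrow> (s, t) \<in> R \<or> (t, s) \<in> R" for s t and R :: "'a rel"
        by (auto simp: symcl_def)
      then show ?thesis
        unfolding arcs ij(1,3) using mem ij(2,4) by (simp only: px o_apply)
    qed
  qed
  show ?thesis
    unfolding has_multi_chain_ordering_def using v0 multi_chain_ordering_v0 by blast
qed

end
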